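(* For every integer $n\ge 1$ there exists a constant $c_n>0$, depending only on $n$, such that for every non-degenerate $\mathbb{C}$-convex domain $D\subset\mathbb{C}^n$ one has $s_D(p)\ge c_n$ for all $p\in D$, where $s_D$ denotes the squeezing function of $D$.
   Context: A domain is a non-empty connected open set. A domain $D$ in $\mathbb{C}^n$ is called $\mathbb{C}$-convex if every non-empty intersection of $D$ with a complex line (a one-dimensional complex affine subspace of $\mathbb{C}^n$) is a simply connected domain (in that line). A domain is called degenerate if it contains a complex line, and non-degenerate otherwise. $D$ is not assumed to be bounded. Squeezing function: let $\mathbb{B}_n$ denote the open unit ball in $\mathbb{C}^n$. Let $M$ be an $n$-dimensional complex manifold (for example a domain in $\mathbb{C}^n$) and $p\in M$. For a holomorphic embedding $f:M\to\mathbb{B}_n$ with $f(p)=0$, set $s_M(f,p)=\sup\{r>0: r\mathbb{B}_n\subset f(M)\}$. The squeezing function of $M$ is $s_M(p)=\sup_f s_M(f,p)$, the supremum being over all such $f$, if such $f$ exist, and $s_M(p)=0$ otherwise. *)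

theory Defs
  imports "HOL-Analysis.Analysis"
begin

definition is_domain :: "'a::topological_space set \<Rightarrow> bool" where
  "is_domain D \<longleftrightarrow> D \<noteq> {} \<and> connected D \<and> open D"

definition complex_line :: "(complex ^ 'n) set \<Rightarrow> bool" where
  "complex_line L \<longleftrightarrow> (\<exists>a v. v \<noteq> 0 \<and> L = {a + t *s v | t. True})"

definition C_convex_domain :: "(complex ^ 'n) set \<Rightarrow> bool" where
  "C_convex_domain D \<longleftrightarrow> is_domain D \<and>
     (\<forall>L. complex_line L \<and> D \<inter> L \<noteq> {} \<longrightarrow>
        openin (top_of_set L) (D \<inter> L) \<and> connected (D \<inter> L) \<and> simply_connected (D \<inter> L))"

definition degenerate :: "(complex ^ 'n) set \<Rightarrow> bool" where
  "degenerate D \<longleftrightarrow> (\<exists>L. complex_line L \<and> L \<subseteq> D)"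

text \<open>Intended for open sets: the real Frechet derivative exists at every point and is
  complex linear.\<close>

definition holomorphic_map_on :: "(complex ^ 'n \<Rightarrow> complex ^ 'm) \<Rightarrow> (complex ^ 'n) set \<Rightarrow> bool" where
  "holomorphic_map_on f D \<longleftrightarrow>
     (\<forall>z\<in>D. \<exists>A. (f has_derivative A) (at z) \<and> Vector_Spaces.linear (*s) (*s) A)"

text \<open>An immersion that is a homeomorphism onto its image; the image need not be closed
  in the target \<open>W\<close>.\<close>

definition holomorphic_embedding ::
    "(complex ^ 'n) set \<Rightarrow> (complex ^ 'm) set \<Rightarrow> (complex ^ 'n \<Rightarrow> complex ^ 'm) \<Rightarrow> bool" where
  "holomorphic_embedding D W f \<longleftrightarrow>
     f ` D \<subseteq> W \<and> holomorphic_map_on f D \<and>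
     (\<forall>z\<in>D. inj (frechet_derivative f (at z))) \<and>
     (\<exists>g. homeomorphism D (f ` D) f g)"

text \<open>The norm of \<open>complex ^ 'n\<close> is the Hermitian one, so \<open>ball 0 1\<close> is the Euclidean unit ball.
  For a domain \<open>D\<close> containing \<open>p\<close>, both suprema below are over sets bounded by 1; the first set is
  non-empty since \<open>f ` D\<close> is open (invariance of domain) and contains 0.\<close>

definition squeezing_at :: "(complex ^ 'n) set \<Rightarrow> (complex ^ 'n \<Rightarrow> complex ^ 'n) \<Rightarrow> real" where
  "squeezing_at D f = Sup {r. r > 0 \<and> ball 0 r \<subseteq> f ` D}"

definition centred_embeddings ::
    "(complex ^ 'n) set \<Rightarrow> complex ^ 'n \<Rightarrow> (complex ^ 'n \<Rightarrow> complex ^ 'n) set" where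
  "centred_embeddings D p = {f. holomorphic_embedding D (ball 0 1) f \<and> f p = 0}"

definition squeezing_function :: "(complex ^ 'n) set \<Rightarrow> complex ^ 'n \<Rightarrow> real" where
  "squeezing_function D p =
     (if centred_embeddings D p = {} then 0
      else Sup (squeezing_at D ` centred_embeddings D p))"

end

theory Submission
  imports Defs "HOL-Complex_Analysis.Riemann_Mapping"
begin

text \<open>
  An affine change of coordinates brings every non-degenerate \<open>\<complex>\<close>-convex domain of \<open>\<complex>\<^sup>n\<close> with a base
  point \<open>p\<close> into a normal position whose constants depend on \<open>n\<close> only: \<open>p\<close> is the origin, the domain contains
  the ball of radius \<open>1 / sqrt n\<close>, and none of the coordinate functions takes the value 1
  (\<open>C_convex_normal_position\<close>). In this position an embedding into the unit ball can be written down
  coordinate by coordinate. The function \<open>1 - w $ i\<close> has no zeros and has a continuous square root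
  \<open>g i\<close>; this root omits a disc about \<open>-1\<close> of radius proportional to \<open>1 / sqrt n\<close>
  (\<open>square_root_branch\<close>), so that a Moebius transformation of \<open>g i\<close> is bounded. The \<open>n\<close> functions
  obtained in this way embed the domain into the ball, and the image contains the ball of radius
  \<open>1 / (144 * n\<^sup>2)\<close> about the image of \<open>p\<close> (\<open>normal_position_embedding\<close>).

  The normal position comes from a supply of complex hyperplanes missing the domain. Whenever an
  ellipsoid inside the domain touches the complement, its complex tangent hyperplane at
  the touching point misses the domain (\<open>C_convex_touching_hyperplane\<close>, combined with
  \<open>C_convex_affine_preimage\<close>). If the hyperplanes missing
  the domain were all parallel to a common direction, ellipsoids stretched in this direction would
  exhaust a complex line in the domain (\<open>span_dual_complement\<close>); so non-degeneracy provides \<open>n\<close>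
  linearly independent ones. Choosing them with maximal determinant turns them into the hyperplanes
  where a coordinate equals 1, and maximality together with the touching property bounds the
  distance from the origin to the complement from below.

  Topology enters through one fact only (\<open>continuous_log_of_ratio_along_lines\<close>): because the slices of
  the domain by lines are simply connected, logarithms of non-vanishing functions can be continued
  along the lines joining two moving points, and the result depends continuously on the points.
  Applied to the lines through the base point it yields the square roots; applied to a circle of
  lines through a touching point it would yield a logarithm of the identity of the circle, and this
  contradiction proves the tangent hyperplane property.
\<close>

section \<open>Complex lines and affine coordinates\<close>

text \<open>
  The defining property of \<open>\<complex>\<close>-convexity speaks about subsets of lines in \<open>\<complex>\<^sup>n\<close>. Pulled back to the
  parameter of the line it becomes a statement about plane sets, for which simple connectivity is
  equivalent to the existence of continuous logarithms. The slice may be empty here.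
\<close>
lemma C_convex_slice:
  fixes D :: "(complex ^ 'n) set"
  assumes D: "C_convex_domain D" and v: "v \<noteq> 0"
  shows "open {t. a + t *s v \<in> D}" "connected {t. a + t *s v \<in> D}"
    "simply_connected {t. a + t *s v \<in> D}"
proof -
  define U where "U = {t. a + t *s v \<in> D}"
  define L where "L = {a + t *s v | t. True}"
  have L: "complex_line L"
    unfolding complex_line_def L_def using v by blast
  obtain k where k: "v $ k \<noteq> 0"
    using v by (auto simp: vec_eq_iff)
  have cont: "continuous_on X (\<lambda>t. a + t *s v)" for X
    by (auto simp: vector_scalar_mult_def intro!: continuous_intros)
  have oD: "open D"
    using D by (simp add: C_convex_domain_def is_domain_def)
  show "open {t. a + t *s v \<in> D}"
    using open_vimage[OF oD cont] by (simp add: vimage_def)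
  have hom: "homeomorphism U (D \<inter> L) (\<lambda>t. a + t *s v) (\<lambda>z. (z $ k - a $ k) / v $ k)"
  proof (rule homeomorphismI)
    show "continuous_on (D \<inter> L) (\<lambda>z. (z $ k - a $ k) / v $ k)"
      using k by (intro continuous_intros) auto
  qed (auto simp: U_def L_def k cont)
  have hom': "D \<inter> L homeomorphic U"
    using hom by (meson homeomorphic_def homeomorphic_sym)
  have DL: "connected (D \<inter> L) \<and> simply_connected (D \<inter> L)"
    using D L by (cases "D \<inter> L = {}") (auto simp: C_convex_domain_def)
  have "connected U"
    using DL hom' homeomorphic_connectedness by blast
  then show "connected {t. a + t *s v \<in> D}" by (simp add: U_def)
  have "simply_connected U"
    using DL hom' homeomorphic_simply_connected by blast
  then show "simply_connected {t. a + t *s v \<in> D}" by (simp add: U_def)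
qed

text \<open>
  Affine bijections map lines to lines, so every later statement about balls applies to
  arbitrary ellipsoids as well.
\<close>
lemma C_convex_affine_preimage:
  fixes D :: "(complex ^ 'n) set" and A B :: "complex ^ 'n ^ 'n"
  assumes D: "C_convex_domain D" and AB: "A ** B = mat 1"
  shows "C_convex_domain {w. p + A *v w \<in> D}"
proof -
  define E where "E = {w. p + A *v w \<in> D}"
  define \<phi> where "\<phi> = (\<lambda>w. p + A *v w)"
  define \<psi> where "\<psi> = (\<lambda>z. B *v (z - p))"
  have BA: "B ** A = mat 1"
    using AB matrix_left_right_inverse by blast
  have \<psi>\<phi>: "\<psi> (\<phi> w) = w" for w
    by (simp add: \<phi>_def \<psi>_def matrix_vector_mul_assoc BA)
  have \<phi>\<psi>: "\<phi> (\<psi> z) = z" for z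
    by (simp add: \<phi>_def \<psi>_def matrix_vector_mul_assoc AB)
  have c\<phi>: "continuous_on X \<phi>" for X
    unfolding \<phi>_def by (intro continuous_intros linear_continuous_on matrix_vector_mul_bounded_linear)
  have c\<psi>: "continuous_on X \<psi>" for X
    unfolding \<psi>_def
    by (intro continuous_on_compose2[OF linear_continuous_on[OF matrix_vector_mul_bounded_linear, of UNIV B]]
        continuous_intros) auto
  have E_mem: "w \<in> E \<longleftrightarrow> \<phi> w \<in> D" for w
    by (simp add: E_def \<phi>_def)
  have E_eq: "E = \<psi> ` D"
  proof
    show "E \<subseteq> \<psi> ` D"
      using \<psi>\<phi> by (metis E_mem image_eqI subsetI)
    show "\<psi> ` D \<subseteq> E"
      using E_mem \<phi>\<psi> by auto
  qed
  have dD: "D \<noteq> {}" "connected D" "open D"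
    using D by (auto simp: C_convex_domain_def is_domain_def)
  have oE: "open E"
    using open_vimage[OF dD(3) c\<phi>] by (simp add: vimage_def E_def \<phi>_def)
  have "connected E"
    unfolding E_eq using connected_continuous_image[OF c\<psi> dD(2)] .
  with oE dD(1) have dom: "is_domain E"
    by (simp add: is_domain_def E_eq)
  have "openin (top_of_set L) (E \<inter> L) \<and> connected (E \<inter> L) \<and> simply_connected (E \<inter> L)"
    if L: "complex_line L" and ne: "E \<inter> L \<noteq> {}" for L
  proof -
    obtain a v where v: "v \<noteq> 0" and L_eq: "L = {a + t *s v | t. True}"
      using L by (auto simp: complex_line_def)
    have Av: "A *v v \<noteq> 0"
      using v by (metis BA matrix_vector_mul_assoc matrix_vector_mul_lid matrix_vector_mult_0_right)
    define L' where "L' = {\<phi> a + t *s (A *v v) | t. True}"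
    have L': "complex_line L'"
      unfolding complex_line_def L'_def using Av by blast
    have \<phi>_line: "\<phi> (a + t *s v) = \<phi> a + t *s (A *v v)" for t
      by (simp add: \<phi>_def vec.add vec.scale)
    have \<phi>_L: "\<phi> z \<in> L'" if "z \<in> L" for z
      using that \<phi>_line by (auto simp: L_eq L'_def)
    have \<psi>_L: "\<psi> z \<in> L" if zL': "z \<in> L'" for z
    proof -
      obtain t where "z = \<phi> a + t *s (A *v v)" using zL' by (auto simp: L'_def)
      then have "z = \<phi> (a + t *s v)" by (simp only: \<phi>_line)
      then show ?thesis using \<psi>\<phi> by (auto simp: L_eq)
    qed
    have im: "\<phi> ` (E \<inter> L) = D \<inter> L'"
    proof
      show "\<phi> ` (E \<inter> L) \<subseteq> D \<inter> L'" using E_mem \<phi>_L by auto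
      show "D \<inter> L' \<subseteq> \<phi> ` (E \<inter> L)"
      proof
        fix z assume "z \<in> D \<inter> L'"
        then have "\<psi> z \<in> E \<inter> L" using E_mem \<phi>\<psi> \<psi>_L by auto
        then show "z \<in> \<phi> ` (E \<inter> L)" using \<phi>\<psi> by (metis imageI)
      qed
    qed
    have hom: "homeomorphism (E \<inter> L) (D \<inter> L') \<phi> \<psi>"
      by (rule homeomorphismI[OF c\<phi> c\<psi>]) (auto simp: im[symmetric] image_image \<psi>\<phi> \<phi>\<psi>)
    then have hom': "D \<inter> L' homeomorphic E \<inter> L"
      by (meson homeomorphic_def homeomorphic_sym)
    have "D \<inter> L' \<noteq> {}" using ne im by blast
    then have "connected (D \<inter> L')" "simply_connected (D \<inter> L')"
      using D L' by (auto simp: C_convex_domain_def)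
    then show ?thesis
      using hom' homeomorphic_connectedness homeomorphic_simply_connected oE
      by (metis openin_open_Int inf_commute)
  qed
  with dom show ?thesis by (simp add: C_convex_domain_def E_def)
qed

section \<open>Logarithms along complex lines\<close>

text \<open>
  Two continuous logarithms of one function on a connected set differ by a constant.
\<close>
lemma continuous_exp_eq_1_imp_constant:
  fixes u :: "'a::topological_space \<Rightarrow> complex"
  assumes K: "connected K" and u: "continuous_on K u"
    and e: "\<And>x. x \<in> K \<Longrightarrow> exp (u x) = 1" and "a \<in> K" "b \<in> K"
  shows "u a = u b"
proof -
  have "u constant_on K"
  proof (rule continuous_discrete_range_constant[OF K u])
    fix x assume x: "x \<in> K"
    show "\<exists>e>0. \<forall>y. y \<in> K \<and> u y \<noteq> u x \<longrightarrow> e \<le> norm (u y - u x)"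
    proof (intro exI[of _ "2 * pi"] conjI allI impI)
      fix y assume y: "y \<in> K \<and> u y \<noteq> u x"
      show "2 * pi \<le> norm (u y - u x)"
      proof (rule ccontr)
        assume "\<not> ?thesis"
        moreover have "\<bar>Im (u y) - Im (u x)\<bar> \<le> cmod (u y - u x)"
          by (metis abs_Im_le_cmod minus_complex.simps(2))
        ultimately have "\<bar>Im (u y) - Im (u x)\<bar> < 2 * pi" by linarith
        moreover have "exp (u y) = exp (u x)" by (simp only: e x conjunct1[OF y])
        ultimately have "u y = u x" by (rule exp_complex_eqI)
        with y show False by simp
      qed
    qed auto
  qed
  then show ?thesis using assms by (auto simp: constant_on_def)
qed

text \<open>
  The change of a logarithm of \<open>f\<close> along a path from \<open>x w\<close> to \<open>y w\<close> inside the slice of \<open>D\<close> by the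
  line through these two points does not depend on the path, because the slice is simply connected.
  It varies continuously with \<open>w\<close>: a path that serves for \<open>w0\<close>, expressed in the affine parameter of
  the line, still runs inside the slices of all nearby \<open>w\<close>, by compactness. This single principle is
  used twice below. With \<open>x\<close> constant and \<open>y\<close> the identity it yields logarithms on all of \<open>D\<close>; on a
  circle of lines it yields an obstruction.
\<close>
lemma continuous_log_of_ratio_along_lines:
  fixes D :: "(complex ^ 'n) set" and W :: "'w::metric_space set"
    and x y :: "'w \<Rightarrow> complex ^ 'n" and f :: "complex ^ 'n \<Rightarrow> complex"
  assumes D: "C_convex_domain D"
    and x: "continuous_on W x" "x ` W \<subseteq> D" and y: "continuous_on W y" "y ` W \<subseteq> D"
    and f: "continuous_on UNIV f"
    and nz: "\<And>w t. w \<in> W \<Longrightarrow> x w + t *s (y w - x w) \<in> D \<Longrightarrow> f (x w + t *s (y w - x w)) \<noteq> 0"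
  shows "\<exists>c. continuous_on W c \<and> (\<forall>w\<in>W. exp (c w) = f (y w) / f (x w))"
proof -
  \<comment> \<open>In the parameter \<open>t\<close> both end points are independent of \<open>w\<close>, namely 0 and 1.\<close>
  define h where "h = (\<lambda>w t. x w + t *s (y w - x w))"
  define U where "U = (\<lambda>w. {t. h w t \<in> D})"
  have oD: "open D"
    using D by (simp add: C_convex_domain_def is_domain_def)
  have U: "open (U w) \<and> connected (U w) \<and> simply_connected (U w)" if "w \<in> W" for w
  proof (cases "y w = x w")
    case True
    then have "U w = UNIV" using x(2) that by (auto simp: U_def h_def)
    then show ?thesis by (simp add: convex_imp_simply_connected connected_UNIV)
  next
    case False
    then show ?thesis
      using C_convex_slice[OF D, of "y w - x w" "x w"] by (simp add: U_def h_def)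
  qed
  have U01: "0 \<in> U w" "1 \<in> U w" if "w \<in> W" for w
    using that x(2) y(2) by (auto simp: U_def h_def)
  have h_cont: "continuous_on X (h w)" for w X
    unfolding h_def by (auto simp: vector_scalar_mult_def intro!: continuous_intros)
  have h_cont2: "continuous_on (W \<times> K) (\<lambda>(w, t). h w t)" for K
    unfolding h_def vector_scalar_mult_def split_beta
    by (intro continuous_intros continuous_on_compose2[OF x(1)] continuous_on_compose2[OF y(1)]) auto
  have f_comp: "continuous_on X (\<lambda>p. f (g p))" if "continuous_on X g"
    for X :: "'z::topological_space set" and g
    using continuous_on_compose2[OF f that] by simp
  have fnz: "f (h w t) \<noteq> 0" if "w \<in> W" "t \<in> U w" for w t
    using nz that by (auto simp: U_def h_def)
  have "\<exists>G. continuous_on (U w) G \<and> (\<forall>t\<in>U w. f (h w t) = exp (G t))" if w: "w \<in> W" for w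
    using simply_connected_eq_continuous_log[of "U w"] U[OF w] fnz[OF w] f_comp[OF h_cont]
    by blast
  then obtain G where G: "\<And>w. w \<in> W \<Longrightarrow> continuous_on (U w) (G w)"
    "\<And>w t. w \<in> W \<Longrightarrow> t \<in> U w \<Longrightarrow> f (h w t) = exp (G w t)"
    by metis
  define c where "c = (\<lambda>w. G w 1 - G w 0)"
  have c_exp: "exp (c w) = f (y w) / f (x w)" if "w \<in> W" for w
    using G(2)[OF that U01(1)[OF that]] G(2)[OF that U01(2)[OF that]]
    by (simp add: c_def exp_diff h_def)
  have "continuous_on W c"
    unfolding continuous_on_iff
  proof (intro ballI allI impI)
    fix w0 and e :: real assume w0: "w0 \<in> W" and e: "e > 0"
    have "path_connected (U w0)"
      using U[OF w0] by (simp add: connected_open_path_connected)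
    then obtain \<gamma> where \<gamma>: "path \<gamma>" "path_image \<gamma> \<subseteq> U w0" "pathstart \<gamma> = 0" "pathfinish \<gamma> = 1"
      using U01[OF w0] unfolding path_connected_def by meson
    define K where "K = path_image \<gamma>"
    have K: "compact K" "connected K" "0 \<in> K" "1 \<in> K" "K \<subseteq> U w0"
      using \<gamma> unfolding K_def
      by (auto simp: compact_path_image connected_path_image)
        (metis pathstart_in_path_image pathfinish_in_path_image)+
    \<comment> \<open>The path chosen for \<open>w0\<close> lies in the slices of all \<open>w\<close> in a neighbourhood \<open>X1\<close>.\<close>
    have "compact (h w0 ` K)"
      using K(1) h_cont compact_continuous_image by blast
    moreover have "h w0 ` K \<subseteq> D"
      using K(5) by (auto simp: U_def)
    ultimately obtain d where d: "d > 0" "(\<Union>z\<in>h w0 ` K. ball z d) \<subseteq> D"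
      using compact_subset_open_imp_ball_epsilon_subset[OF _ oD] by metis
    have d2: "d / 2 > 0" using d(1) by simp
    obtain X1 where X1: "w0 \<in> X1" "open X1"
      "\<forall>w\<in>X1 \<inter> W. \<forall>t\<in>K. dist (h w t) (h w0 t) \<le> d/2"
      by (rule continuous_on_prod_compactE[OF h_cont2 K(1) w0 d2]) (simp only: prod.case)
    have "h w t \<in> D" if "w \<in> X1 \<inter> W" "t \<in> K" for w t
    proof -
      have "h w t \<in> ball (h w0 t) d"
        using X1(3)[rule_format, OF that] d(1) by (simp add: dist_commute)
      then show ?thesis using d(2) that by blast
    qed
    then have KU: "K \<subseteq> U w" if "w \<in> X1 \<inter> W" for w
      using that by (auto simp: U_def)
    define q where "q = (\<lambda>w t. f (h w t) / f (h w0 t))"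
    have q_cont: "continuous_on (W \<times> K) (\<lambda>(w, t). q w t)"
    proof -
      have "continuous_on (W \<times> K) (\<lambda>p. f (case p of (w, t) \<Rightarrow> h w t) / f (h w0 (snd p)))"
        using fnz[OF w0] K(5)
        by (intro continuous_on_divide f_comp h_cont2 continuous_on_compose2[OF h_cont[of UNIV]] continuous_intros)
          auto
      then show ?thesis by (simp add: q_def split_beta)
    qed
    define e' where "e' = min (1/4) (e/8)"
    have e': "e' > 0" "e' < 1/2" using e by (auto simp: e'_def)
    obtain X2 where X2: "w0 \<in> X2" "open X2"
      "\<forall>w\<in>X2 \<inter> W. \<forall>t\<in>K. dist (q w t) (q w0 t) \<le> e'"
      by (rule continuous_on_prod_compactE[OF q_cont K(1) w0 e'(1)]) (simp only: prod.case)
    have main: "dist (c w) (c w0) < e" if w: "w \<in> X1" "w \<in> X2" "w \<in> W" for w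
    proof -
      have q1: "norm (q w t - 1) \<le> e'" if "t \<in> K" for t
      proof -
        have "q w0 t = 1" using fnz[OF w0] K(5) that by (auto simp: q_def)
        then show ?thesis using X2(3)[rule_format, of w t] that w by (simp add: dist_norm)
      qed
      have Re_q: "Re (q w t) > 0" if "t \<in> K" for t
      proof -
        have "\<bar>Re (q w t - 1)\<bar> \<le> e'" using q1[OF that] abs_Re_le_cmod order_trans by blast
        then show ?thesis using e' by auto
      qed
      have Ln_small: "norm (Ln (q w t)) \<le> 2 * e'" if "t \<in> K" for t
        using norm_Ln_le[of "q w t - 1"] q1[OF that] e' by simp
      define u where "u = (\<lambda>t. G w t - G w0 t - Ln (q w t))"
      \<comment> \<open>Along the path the two logarithms differ by the principal logarithm of the quotient
        \<open>q\<close>, which is close to 1, up to a constant.\<close>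
      have "u 0 = u 1"
      proof (rule continuous_exp_eq_1_imp_constant[of K u, OF K(2)])
        have qc: "continuous_on K (q w)"
          unfolding q_def using fnz[OF w0] K(5) by (intro continuous_intros f_comp h_cont) auto
        have "q w t \<notin> \<real>\<^sub>\<le>\<^sub>0" if "t \<in> K" for t
          using Re_q[OF that] by (auto simp: complex_nonpos_Reals_iff)
        then show "continuous_on K u"
          unfolding u_def using K(5) KU[of w] w w0
          by (intro continuous_intros qc continuous_on_subset[OF G(1)]) auto
        show "exp (u t) = 1" if t: "t \<in> K" for t
        proof -
          have "t \<in> U w" "t \<in> U w0" using K(5) KU[of w] w t by auto
          then have "exp (G w t) = f (h w t)" "exp (G w0 t) = f (h w0 t)"
            using G(2) w w0 by auto
          moreover have "exp (Ln (q w t)) = q w t"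
            using Re_q[OF t] by (metis exp_Ln less_irrefl zero_complex.sel(1))
          moreover have "f (h w t) \<noteq> 0" "f (h w0 t) \<noteq> 0"
            using fnz \<open>t \<in> U w\<close> \<open>t \<in> U w0\<close> w w0 by auto
          ultimately show ?thesis by (simp add: u_def exp_diff q_def)
        qed
      qed (use K in auto)
      then have "c w - c w0 = Ln (q w 1) - Ln (q w 0)"
        by (simp add: u_def c_def algebra_simps)
      then have "norm (c w - c w0) \<le> 4 * e'"
        using Ln_small[OF K(3)] Ln_small[OF K(4)] norm_triangle_ineq4[of "Ln (q w 1)" "Ln (q w 0)"]
        by simp
      also have "\<dots> < e" using e by (auto simp: e'_def min_def)
      finally show ?thesis by (simp add: dist_norm)
    qed
    have "open (X1 \<inter> X2)" "w0 \<in> X1 \<inter> X2" using X1 X2 by auto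
    then obtain \<delta> where "\<delta> > 0" "ball w0 \<delta> \<subseteq> X1 \<inter> X2"
      using open_contains_ball by metis
    then show "\<exists>d>0. \<forall>w\<in>W. dist w w0 < d \<longrightarrow> dist (c w) (c w0) < e"
      using main by (intro exI[of _ \<delta>]) (auto simp: dist_commute subset_iff)
  qed
  with c_exp show ?thesis by blast
qed

section \<open>Touching balls\<close>

definition hinner :: "complex ^ 'n \<Rightarrow> complex ^ 'n \<Rightarrow> complex" where
  "hinner z w = (\<Sum>i\<in>UNIV. z $ i * cnj (w $ i))"

lemma hinner_simps:
  "hinner 0 z = 0" "hinner z 0 = 0" "hinner (- x) z = - hinner x z" "hinner z (- x) = - hinner z x"
  "hinner (x + y) z = hinner x z + hinner y z"
  "hinner (x - y) z = hinner x z - hinner y z"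
  "hinner (a *s x) z = a * hinner x z"
  "hinner z (x + y) = hinner z x + hinner z y"
  "hinner z (a *s x) = cnj a * hinner z x"
  by (simp_all add: hinner_def algebra_simps sum.distrib sum_subtractf sum_distrib_left sum_negf)

lemma hinner_commute: "hinner z w = cnj (hinner w z)"
  by (simp add: hinner_def mult.commute)

lemma hinner_self: "hinner z z = complex_of_real ((norm z)\<^sup>2)"
  by (simp add: hinner_def complex_norm_square[symmetric] norm_vec_def L2_set_def
      real_sqrt_pow2 sum_nonneg)

lemma norm_add_orthogonal:
  assumes "hinner x y = 0"
  shows "(norm (x + y))\<^sup>2 = (norm x)\<^sup>2 + (norm y)\<^sup>2"
proof -
  have "complex_of_real ((norm (x + y))\<^sup>2) = complex_of_real ((norm x)\<^sup>2 + (norm y)\<^sup>2)"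
    using assms hinner_commute[of y x] unfolding of_real_add hinner_self[symmetric]
    by (simp add: hinner_simps)
  then show ?thesis using of_real_eq_iff by blast
qed

lemma norm_vector_scalar_mult: "norm (c *s (x :: complex ^ 'n)) = cmod c * norm x"
proof -
  have "complex_of_real ((norm (c *s x))\<^sup>2) = complex_of_real ((cmod c * norm x)\<^sup>2)"
    unfolding hinner_self[symmetric] power_mult_distrib of_real_mult
    using complex_norm_square[of c] by (simp add: hinner_simps mult.commute)
  then have "(norm (c *s x))\<^sup>2 = (cmod c * norm x)\<^sup>2" using of_real_eq_iff by blast
  then show ?thesis by (simp add: power2_eq_iff_nonneg)
qed

lemma continuous_on_hinner [continuous_intros]:
  "continuous_on X f \<Longrightarrow> continuous_on X (\<lambda>x. hinner (f x) w)"
  unfolding hinner_def by (intro continuous_intros)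

lemma continuous_on_vector_scalar_mult [continuous_intros]:
  fixes x :: "'a::topological_space \<Rightarrow> complex ^ 'n"
  assumes "continuous_on X c" "continuous_on X x"
  shows "continuous_on X (\<lambda>t. c t *s x t)"
  unfolding vector_scalar_mult_def using assms by (intro continuous_intros)

text \<open>
  A logarithm of \<open>k * w\<close> along the circle would have to grow by \<open>2 * pi * \<i>\<close> in one turn.
\<close>
lemma no_continuous_log_on_circle:
  fixes k :: complex
  assumes "continuous_on (sphere 0 1) c" "\<And>w. w \<in> sphere 0 1 \<Longrightarrow> exp (c w) = k * w"
  shows False
proof -
  define u where "u = (\<lambda>t::real. c (cis t) - c 1 - \<i> * t)"
  have k: "k = exp (c 1)" using assms(2)[of 1] by simp
  have "u 0 = u (2 * pi)"
  proof (rule continuous_exp_eq_1_imp_constant[of "{0..2 * pi}"])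
    show "continuous_on {0..2 * pi} u"
      unfolding u_def
      by (intro continuous_intros continuous_on_compose2[OF assms(1)]) auto
    show "exp (u t) = 1" for t
      using assms(2)[of "cis t"] by (simp add: u_def exp_diff k cis_conv_exp)
  qed auto
  then show False by (simp add: u_def cis_2pi)
qed

text \<open>
  Suppose that \<open>a\<close> lies in \<open>D\<close> and in the complex hyperplane tangent to the ball at \<open>q\<close>, and put \<open>v = a - q\<close>. For \<open>w\<close> on the unit circle
  consider the line through \<open>q\<close> in the direction \<open>v + \<delta> w q\<close>. For small \<open>\<delta>\<close> it passes through the point
  \<open>y w = a + \<delta> w q\<close> near \<open>a\<close>. Being transversal to the tangent hyperplane it also enters the ball: a point
  \<open>q + s (v + \<delta> w q)\<close> with small \<open>s\<close> lies in the ball if \<open>s w\<close> is negative, so \<open>s = - \<eta> * cnj w\<close> gives a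
  suitable point \<open>x w\<close>. On each of these lines the linear
  function \<open>f\<close> vanishes only at \<open>q\<close>, which is not in \<open>D\<close>. So \<open>f (y w) / f (x w)\<close>, a constant multiple of
  \<open>w\<close>, has a continuous logarithm on the circle, which is absurd.
\<close>
lemma C_convex_touching_hyperplane:
  fixes D :: "(complex ^ 'n) set"
  assumes D: "C_convex_domain D" and ball: "ball 0 (norm q) \<subseteq> D" and q: "q \<notin> D" "q \<noteq> 0"
    and a: "a \<in> D"
  shows "hinner a q \<noteq> hinner q q"
proof
  assume eq: "hinner a q = hinner q q"
  define v where "v = a - q"
  have qv: "hinner v q = 0" "hinner q v = 0"
    using eq hinner_commute[of q v] by (simp_all add: v_def hinner_simps)
  have a_eq: "a = q + v" by (simp add: v_def)
  have nq: "norm q > 0" using q by simp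
  obtain e where e: "e > 0" "ball a e \<subseteq> D"
    using a D open_contains_ball by (metis C_convex_domain_def is_domain_def)
  define \<delta> where "\<delta> = e / (2 * norm q)"
  have \<delta>: "\<delta> > 0" "\<delta> * norm q < e" using e nq by (auto simp: \<delta>_def)
  define m where "m = \<delta>\<^sup>2 * (norm q)\<^sup>2 + (norm v)\<^sup>2"
  have m: "m > 0" using \<delta> nq by (auto simp: m_def add_pos_nonneg)
  \<comment> \<open>This value minimises the norm of \<open>x w\<close> below, whose square is
    \<open>(norm q)\<^sup>2 - 2 * \<eta> * \<delta> * (norm q)\<^sup>2 + \<eta>\<^sup>2 * m\<close>.\<close>
  define \<eta> where "\<eta> = \<delta> * (norm q)\<^sup>2 / m"
  have \<eta>: "\<eta> > 0" "\<eta> * m = \<delta> * (norm q)\<^sup>2" using \<delta> nq m by (auto simp: \<eta>_def)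
  define W where "W = sphere (0::complex) 1"
  define y where "y = (\<lambda>w::complex. a + (\<delta> * w) *s q)"
  define x where "x = (\<lambda>w::complex. of_real (1 - \<eta> * \<delta>) *s q + (- (\<eta> * cnj w)) *s v)"
  define f where "f = (\<lambda>z. hinner (z - q) q)"
  have "y w \<in> D" if "w \<in> W" for w
  proof -
    have "dist a (y w) = \<delta> * norm q"
      using that \<delta> by (simp add: y_def dist_norm norm_vector_scalar_mult norm_mult W_def)
    then show ?thesis using e \<delta> by auto
  qed
  then have yW: "y ` W \<subseteq> D" by auto
  have "x w \<in> D" if "w \<in> W" for w
  proof -
    have "(norm (x w))\<^sup>2 = (1 - \<eta> * \<delta>)\<^sup>2 * (norm q)\<^sup>2 + \<eta>\<^sup>2 * (norm v)\<^sup>2"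
      unfolding x_def using that \<eta>
      by (subst norm_add_orthogonal)
        (simp_all add: hinner_simps qv norm_vector_scalar_mult norm_mult W_def power_mult_distrib del: of_real_diff)
    also have "\<dots> = (norm q)\<^sup>2 - 2 * \<eta> * \<delta> * (norm q)\<^sup>2 + \<eta> * (\<eta> * m)"
      by (simp add: m_def power2_eq_square algebra_simps)
    also have "\<dots> = (norm q)\<^sup>2 - \<eta> * \<delta> * (norm q)\<^sup>2"
      unfolding \<eta>(2) by simp
    also have "\<dots> < (norm q)\<^sup>2" using \<eta> \<delta> nq by simp
    finally have "norm (x w) < norm q"
      using nq power_less_imp_less_base by fastforce
    then show ?thesis using ball by auto
  qed
  then have xW: "x ` W \<subseteq> D" by auto
  have line: "x w + t *s (y w - x w) = q + (t * (1 + \<eta> * cnj w) - \<eta> * cnj w) *s (v + (\<delta> * w) *s q)"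
    if "w \<in> W" for w t :: complex
  proof -
    have "w * cnj w = 1" using that by (simp add: W_def complex_norm_square[symmetric])
    then have "cnj w * w = 1" by (simp add: mult.commute)
    then have *: "of_real \<eta> * cnj w * (of_real \<delta> * w) = of_real (\<eta> * \<delta>)" by simp
    show ?thesis
      unfolding vec_eq_iff
    proof
      fix i
      have "x w $ i + t * (y w $ i - x w $ i) - (q $ i + (t * (1 + \<eta> * cnj w) - \<eta> * cnj w) * (v $ i + (\<delta> * w) * q $ i))
        = (t - 1) * q $ i * (of_real (\<eta> * \<delta>) - of_real \<eta> * cnj w * (of_real \<delta> * w))"
        by (simp add: x_def y_def a_eq algebra_simps)
      then show "(x w + t *s (y w - x w)) $ i = (q + (t * (1 + \<eta> * cnj w) - \<eta> * cnj w) *s (v + (\<delta> * w) *s q)) $ i"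
        by (simp only: * right_minus_eq vector_add_component vector_minus_component
            vector_smult_component diff_self mult_zero_right)
    qed
  qed
  have "\<exists>c. continuous_on W c \<and> (\<forall>w\<in>W. exp (c w) = f (y w) / f (x w))"
  proof (rule continuous_log_of_ratio_along_lines[OF D _ xW _ yW])
    show "continuous_on W x" "continuous_on W y" "continuous_on UNIV f"
      unfolding x_def y_def f_def by (intro continuous_intros)+
  next
    fix w t assume w: "w \<in> W" and inD: "x w + t *s (y w - x w) \<in> D"
    define s where "s = t * (1 + \<eta> * cnj w) - \<eta> * cnj w"
    have eq: "x w + t *s (y w - x w) = q + s *s (v + (\<delta> * w) *s q)"
      unfolding s_def by (rule line[OF w])
    have "s \<noteq> 0" using inD q unfolding eq by auto
    moreover have "w \<noteq> 0" using w by (auto simp: W_def)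
    ultimately show "f (x w + t *s (y w - x w)) \<noteq> 0"
      unfolding eq using \<delta> nq by (simp add: f_def hinner_simps qv hinner_self)
  qed
  then obtain c where c: "continuous_on W c" "\<And>w. w \<in> W \<Longrightarrow> exp (c w) = f (y w) / f (x w)"
    by blast
  have "exp (c w) = - (1 / of_real \<eta>) * w" if "w \<in> W" for w
  proof -
    have "f (y w) = \<delta> * w * (norm q)\<^sup>2"
      by (simp add: f_def y_def a_eq hinner_simps qv hinner_self)
    moreover have "f (x w) = - (\<eta> * \<delta> * (norm q)\<^sup>2)"
      by (simp add: f_def x_def hinner_simps qv hinner_self algebra_simps)
    ultimately show ?thesis using c(2)[OF that] \<delta> \<eta> nq by simp
  qed
  with c(1) show False
    using no_continuous_log_on_circle unfolding W_def by blast
qed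

lemma C_convex_nearest_point_hyperplane:
  fixes D :: "(complex ^ 'n) set"
  assumes D: "C_convex_domain D" and "0 \<in> D" and R: "\<not> ball 0 R \<subseteq> D"
  obtains q where "q \<noteq> 0" "q \<notin> D" "norm q < R" "\<And>z. z \<in> D \<Longrightarrow> hinner z q \<noteq> (norm q)\<^sup>2"
proof -
  have "closed (- D)" "- D \<noteq> {}"
    using D R by (auto simp: C_convex_domain_def is_domain_def)
  then obtain q where q: "q \<in> - D" "\<And>y. y \<in> - D \<Longrightarrow> dist 0 q \<le> dist 0 y"
    using distance_attains_inf by metis
  have q0: "q \<noteq> 0" using q(1) \<open>0 \<in> D\<close> by auto
  have ball: "ball 0 (norm q) \<subseteq> D"
    using q(2) by (force simp: not_less)
  have "norm q < R"
  proof -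
    obtain z where "z \<notin> D" "norm z < R" using R by (metis mem_ball_0 subsetI)
    then show ?thesis using q(2)[of z] by simp
  qed
  moreover have "hinner z q \<noteq> (norm q)\<^sup>2" if "z \<in> D" for z
    using C_convex_touching_hyperplane[OF D ball _ q0 that] q(1) by (simp add: hinner_self)
  ultimately show thesis using that q0 q(1) by blast
qed

section \<open>The dual complement and normal position\<close>

text \<open>
  Linear functionals on \<open>\<complex>\<^sup>n\<close> are represented by the bilinear product rather than by \<^const>\<open>hinner\<close>, so
  that the rows of a matrix are functionals and Cramer's rule expands functionals in them.
\<close>
definition bdot :: "complex ^ 'n \<Rightarrow> complex ^ 'n \<Rightarrow> complex" where
  "bdot l z = (\<Sum>i\<in>UNIV. l $ i * z $ i)"

text \<open>
  Its non-zero elements are the affine hyperplanes that miss \<open>D\<close> and the origin, each given by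
  the functional that equals 1 on it.
\<close>
definition dual_complement :: "(complex ^ 'n) set \<Rightarrow> (complex ^ 'n) set" where
  "dual_complement D = {l. \<forall>z\<in>D. bdot l z \<noteq> 1}"

lemma bdot_scale: "bdot l (a *s z) = a * bdot l z"
  by (simp add: bdot_def sum_distrib_left algebra_simps)

lemma matrix_vector_mult_component_bdot: "(A *v z) $ i = bdot (A $ i) z"
  by (simp add: matrix_vector_mult_def bdot_def)

lemma hinner_matrix_vector_mult:
  "hinner (A *v z) q = bdot (\<Sum>i\<in>UNIV. cnj (q $ i) *s A $ i) z"
  unfolding hinner_def bdot_def matrix_vector_mult_def
  by (simp add: sum_distrib_right sum_distrib_left algebra_simps) (rule sum.swap)

text \<open>
  If \<open>D\<close> contains the ball of radius \<open>e\<close> then no functional in the dual complement has norm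
  larger than \<open>1 / e\<close>, since it would take the value 1 in that ball. Closedness holds because a point of the open set \<open>D\<close>
  where \<open>l\<close> equals 1 can be rescaled to one where a given nearby functional equals 1.
\<close>
lemma compact_dual_complement:
  fixes D :: "(complex ^ 'n) set"
  assumes D: "open D" and "0 \<in> D"
  shows "compact (dual_complement D)"
  unfolding compact_eq_bounded_closed
proof
  obtain e where e: "e > 0" "ball 0 e \<subseteq> D"
    using assms open_contains_ball by metis
  show "bounded (dual_complement D)"
    unfolding bounded_iff
  proof (intro exI[of _ "1 / e"] ballI)
    fix l assume l: "l \<in> dual_complement D"
    show "norm l \<le> 1 / e"
    proof (rule ccontr)
      assume "\<not> ?thesis"
      then have big: "1 / e < norm l" by simp
      then have pos: "norm l > 0" using e(1) by (meson less_trans zero_less_divide_1_iff)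
      define z where "z = (1 / of_real ((norm l)\<^sup>2)) *s (\<chi> i. cnj (l $ i))"
      have "(norm (\<chi> i. cnj (l $ i)) :: real) = norm l"
        by (simp add: norm_vec_def)
      then have "norm z = 1 / norm l"
        using pos unfolding z_def norm_vector_scalar_mult
        by (simp add: norm_divide norm_power norm_mult power2_eq_square)
      also have "\<dots> < e" using big e(1) pos by (simp add: field_simps)
      finally have "z \<in> D" using e(2) by auto
      moreover have "bdot l (\<chi> i. cnj (l $ i)) = of_real ((norm l)\<^sup>2)"
        unfolding hinner_self[symmetric] by (simp add: bdot_def hinner_def)
      then have "bdot l z = 1"
        using pos by (simp add: z_def bdot_scale)
      ultimately show False using l by (auto simp: dual_complement_def)
    qed
  qed
  have "open (- dual_complement D)"
  proof (subst open_subopen, intro ballI)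
    fix l assume "l \<in> - dual_complement D"
    then obtain z where z: "z \<in> D" "bdot l z = 1" by (auto simp: dual_complement_def)
    define P where "P = {m. bdot m z \<noteq> 0}"
    have c: "continuous_on X (\<lambda>m. bdot m z)" for X
      unfolding bdot_def by (intro continuous_intros)
    have oP: "open P"
      unfolding P_def by (intro open_Collect_neq c continuous_intros)
    have "continuous_on P (\<lambda>m. (1 / bdot m z) *s z)"
      by (intro continuous_intros c) (auto simp: P_def)
    then have "open (P \<inter> (\<lambda>m. (1 / bdot m z) *s z) -` D)"
      using oP D by (simp add: continuous_on_open_vimage Int_commute)
    moreover have "l \<in> P \<inter> (\<lambda>m. (1 / bdot m z) *s z) -` D"
      using z by (simp add: P_def)
    moreover have "P \<inter> (\<lambda>m. (1 / bdot m z) *s z) -` D \<subseteq> - dual_complement D"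
      by (auto simp: P_def dual_complement_def bdot_scale intro!: bexI)
    ultimately show "\<exists>T. open T \<and> l \<in> T \<and> T \<subseteq> - dual_complement D"
      by blast
  qed
  then show "closed (dual_complement D)" by (simp add: closed_def)
qed

text \<open>
  The real orthogonal complement of a complex subspace is also its Hermitian orthogonal
  complement, so a real orthogonal vector gives, after conjugation, a complex annihilator.
\<close>
lemma annihilator_exists:
  fixes S :: "(complex ^ 'n) set"
  assumes "vec.span S \<noteq> UNIV"
  obtains v where "v \<noteq> 0" "\<And>l. l \<in> S \<Longrightarrow> bdot l v = 0"
proof -
  define V where "V = vec.span S"
  have V: "subspace V"
    unfolding subspace_def V_def
  proof (intro conjI allI ballI)
    fix c :: real and x assume "x \<in> vec.span S"
    moreover have "c *\<^sub>R x = complex_of_real c *s x"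
      by (simp add: vec_eq_iff) (simp add: scaleR_conv_of_real)
    ultimately show "c *\<^sub>R x \<in> vec.span S" by (simp add: vec.span_scale)
  qed (auto intro: vec.span_zero vec.span_add)
  then have "span V = V" by (simp add: span_eq_iff)
  then have "span V \<noteq> UNIV" using assms by (simp only: V_def not_False_eq_True)
  then obtain a where a: "a \<noteq> 0" "\<And>x. x \<in> V \<Longrightarrow> a \<bullet> x = 0"
    using span_not_UNIV_orthogonal \<open>span V = V\<close> by metis
  have Re: "Re (hinner x a) = a \<bullet> x" for x
    by (simp add: hinner_def inner_vec_def inner_complex_def algebra_simps)
  have "hinner x a = 0" if "x \<in> V" for x
  proof -
    have "\<i> *s x \<in> V" using that by (simp add: V_def vec.span_scale)
    then have "Re (hinner (\<i> *s x) a) = 0" using Re a(2) by metis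
    moreover have "Re (hinner x a) = 0" using Re a(2)[OF that] by simp
    ultimately show ?thesis by (simp add: hinner_simps complex_eq_iff)
  qed
  then have "bdot l (\<chi> i. cnj (a $ i)) = 0" if "l \<in> S" for l
    using vec.span_base[OF that] by (simp add: bdot_def hinner_def V_def)
  moreover have "(\<chi> i. cnj (a $ i)) \<noteq> 0" using a(1) by (auto simp: vec_eq_iff)
  ultimately show thesis using that by blast
qed

text \<open>
  If the functionals in the dual complement had a common zero \<open>v \<noteq> 0\<close>, then \<open>D\<close> would contain the
  line through the origin spanned by \<open>v\<close>. Start with a ball inside \<open>D\<close> and stretch it in the direction \<open>v\<close> to an ellipsoid. The
  stretched ellipsoid remains inside \<open>D\<close>: otherwise some concentric smaller copy touches the
  complement of \<open>D\<close> at a point, and the functional of the tangent hyperplane there belongs to the dual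
  complement. As it annihilates \<open>v\<close>, the touching point is orthogonal to \<open>v\<close>; but there the ellipsoid
  is no larger than the ball. Letting the stretching factor grow, the ellipsoids exhaust the line.
\<close>
lemma span_dual_complement:
  fixes D :: "(complex ^ 'n) set"
  assumes D: "C_convex_domain D" and "0 \<in> D" and nd: "\<not> degenerate D"
  shows "vec.span (dual_complement D) = UNIV"
proof (rule ccontr)
  assume "\<not> ?thesis"
  then obtain v where v: "v \<noteq> 0" "\<And>l. l \<in> dual_complement D \<Longrightarrow> bdot l v = 0"
    using annihilator_exists by blast
  obtain e where e: "e > 0" "ball 0 e \<subseteq> D"
    using assms open_contains_ball by (metis C_convex_domain_def is_domain_def)
  \<comment> \<open>Multiplication by \<open>R\<close> along \<open>v\<close>, and the identity on the orthogonal complement of \<open>v\<close>.\<close>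
  define T :: "real \<Rightarrow> complex ^ 'n ^ 'n" where
    "T R = mat 1 + (\<chi> i j. of_real ((R - 1) / (norm v)\<^sup>2) * (v $ i * cnj (v $ j)))" for R
  have T: "T R *v z = z + (of_real ((R - 1) / (norm v)\<^sup>2) * hinner z v) *s v" for R z
  proof -
    have "((\<chi> i j. of_real ((R - 1) / (norm v)\<^sup>2) * (v $ i * cnj (v $ j))) *v z)
        = (of_real ((R - 1) / (norm v)\<^sup>2) * hinner z v) *s v"
      unfolding vec_eq_iff matrix_vector_mult_def hinner_def
      by (simp add: sum_distrib_left sum_distrib_right mult_ac del: of_real_divide of_real_diff of_real_power)
    then show ?thesis by (simp add: T_def matrix_vector_mult_add_rdistrib)
  qed
  have Tv: "T R *v v = of_real R *s v" for R
  proof -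
    have "T R *v v = (1 + of_real ((R - 1) / (norm v)\<^sup>2) * hinner v v) *s v"
      unfolding T by (simp add: vec_eq_iff algebra_simps)
    also have "1 + of_real ((R - 1) / (norm v)\<^sup>2) * hinner v v = of_real R"
      unfolding hinner_self of_real_mult[symmetric] using v(1) by simp
    finally show ?thesis .
  qed
  have T_inverse: "T R *v (T (1 / R) *v z) = z" if "R > 0" for R z
  proof -
    define h where "h = hinner z v"
    have "hinner (T (1 / R) *v z) v = h + of_real ((1 / R - 1) / (norm v)\<^sup>2) * h * of_real ((norm v)\<^sup>2)"
      by (simp add: T hinner_simps h_def hinner_self)
    also have "\<dots> = h * of_real (1 / R)"
      using v(1) by (simp add: field_simps)
    finally have h': "hinner (T (1 / R) *v z) v = h * of_real (1 / R)" .
    have "T R *v (T (1 / R) *v z) = z + (of_real ((1 / R - 1) / (norm v)\<^sup>2) * h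
        + of_real ((R - 1) / (norm v)\<^sup>2) * (h * of_real (1 / R))) *s v"
      unfolding T[of R] h' unfolding T[of "1/R"] h_def[symmetric]
      by (simp add: vec_eq_iff algebra_simps)
    also have "of_real ((1 / R - 1) / (norm v)\<^sup>2) * h
        + of_real ((R - 1) / (norm v)\<^sup>2) * (h * of_real (1 / R)) = 0"
      using that v(1) by (simp add: field_simps)
    finally show ?thesis by simp
  qed
  have stretched: "T R *v w \<in> D" if R: "R > 0" and w: "norm w < e" for R w
  proof -
    define E where "E = {w. T R *v w \<in> D}"
    have inv: "T R ** T (1 / R) = mat 1"
      using T_inverse[OF R] by (simp add: matrix_eq flip: matrix_vector_mul_assoc)
    have E: "C_convex_domain E"
      using C_convex_affine_preimage[OF D inv, of 0] by (simp add: E_def)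
    have "ball 0 e \<subseteq> E"
    proof (rule ccontr)
      assume "\<not> ?thesis"
      moreover have "0 \<in> E" using \<open>0 \<in> D\<close> by (simp add: E_def)
      ultimately obtain q where q: "q \<noteq> 0" "q \<notin> E" "norm q < e"
        "\<And>z. z \<in> E \<Longrightarrow> hinner z q \<noteq> (norm q)\<^sup>2"
        using C_convex_nearest_point_hyperplane[OF E] by metis
      define q' where "q' = of_real (1 / (norm q)\<^sup>2) *s q"
      define l where "l = (\<Sum>i\<in>UNIV. cnj (q' $ i) *s T (1 / R) $ i)"
      have l: "bdot l z = hinner (T (1 / R) *v z) q / (norm q)\<^sup>2" for z
        unfolding l_def hinner_matrix_vector_mult[symmetric] by (simp add: q'_def hinner_simps)
      have "bdot l z \<noteq> 1" if "z \<in> D" for z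
      proof -
        have "T (1 / R) *v z \<in> E" using T_inverse[OF R] that by (simp add: E_def)
        then show ?thesis using q(1) q(4) by (auto simp: l)
      qed
      then have "bdot l v = 0" using v(2) by (simp add: dual_complement_def)
      then have "hinner v q = 0"
        using q(1) R by (simp add: l Tv hinner_simps)
      then have "T R *v q = q"
        using hinner_commute[of q v] by (simp add: T)
      then show False using q e(2) by (auto simp: E_def)
    qed
    then show ?thesis using w by (auto simp: E_def)
  qed
  have "t *s v \<in> D" for t
  proof -
    define R where "R = cmod t * norm v / e + 1"
    have R: "R > 0" using e(1) by (auto simp: R_def intro: add_nonneg_pos)
    have "norm ((t / of_real R) *s v) = cmod t * norm v / R"
      using R by (simp add: norm_vector_scalar_mult norm_divide)
    also have "\<dots> < e" using e(1) R by (simp add: R_def field_simps)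
    finally have "T R *v ((t / of_real R) *s v) \<in> D" by (rule stretched[OF R])
    then show ?thesis using R by (simp add: vec.scale Tv)
  qed
  moreover have "complex_line {0 + t *s v | t. True}"
    unfolding complex_line_def using v(1) by blast
  ultimately have "degenerate D"
    unfolding degenerate_def by (intro exI[of _ "{0 + t *s v | t. True}"]) auto
  with nd show False by simp
qed

lemma invertible_matrix_with_rows_in:
  fixes S :: "(complex ^ 'n) set"
  assumes "vec.span S = UNIV"
  obtains A :: "complex ^ 'n ^ 'n" where "\<And>i. A $ i \<in> S" "det A \<noteq> 0"
proof -
  obtain B where B: "B \<subseteq> S" "vec.independent B" "S \<subseteq> vec.span B" "card B = vec.dim S"
    using vec.basis_exists by metis
  have spanB: "vec.span B = UNIV"
    using B(1,3) assms by (metis vec.span_mono vec.span_span top.extremum_uniqueI)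
  have "vec.dim S = CARD('n)"
    using assms vec_dim_card[where ?'a = complex and ?'n = 'n] vec.dim_span[of S] by simp
  then have "card B = CARD('n)" using B by simp
  moreover have "finite B" using B(2) vec.finiteI_independent by blast
  ultimately obtain b where b: "bij_betw b (UNIV :: 'n set) B"
    by (metis finite finite_same_card_bij)
  define A :: "complex ^ 'n ^ 'n" where "A = (\<chi> i. b i)"
  have "rows A = B"
    using b by (auto simp: rows_def row_def A_def bij_betw_def)
  then have "\<exists>C. C ** A = mat 1"
    using matrix_left_invertible_span_rows_gen[of A] spanB by simp
  then have "det A \<noteq> 0"
    using invertible_left_inverse invertible_det_nz by blast
  moreover have "A $ i \<in> S" for i
    using b B(1) by (auto simp: A_def bij_betw_def)
  ultimately show thesis using that by blast
qed

lemma maximal_determinant_matrix: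
  fixes S :: "(complex ^ 'n) set"
  assumes S: "compact S" and span: "vec.span S = UNIV"
  obtains A :: "complex ^ 'n ^ 'n" where "\<And>i. A $ i \<in> S" "det A \<noteq> 0"
    "\<And>A'. (\<And>i. A' $ i \<in> S) \<Longrightarrow> cmod (det A') \<le> cmod (det A)"
proof -
  define M :: "(complex ^ 'n ^ 'n) set" where "M = {A. \<forall>i. A $ i \<in> S}"
  have "closed M"
  proof -
    have "M = (\<Inter>i. (\<lambda>A. A $ i) -` S)" by (auto simp: M_def)
    also have "closed \<dots>"
      using S by (intro closed_INT ballI closed_vimage compact_imp_closed continuous_intros)
    finally show ?thesis .
  qed
  moreover have "bounded M"
  proof -
    obtain b where b: "\<And>l. l \<in> S \<Longrightarrow> norm l \<le> b"
      using compact_imp_bounded[OF S] by (auto simp: bounded_iff)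
    have "norm A \<le> (\<Sum>i\<in>(UNIV::'n set). b)" if "A \<in> M" for A
    proof -
      have "norm A \<le> (\<Sum>i\<in>UNIV. norm (A $ i))"
        unfolding norm_vec_def by (rule L2_set_le_sum) simp
      also have "\<dots> \<le> (\<Sum>i\<in>(UNIV::'n set). b)"
        using that b by (intro sum_mono) (auto simp: M_def)
      finally show ?thesis .
    qed
    then show ?thesis unfolding bounded_iff by blast
  qed
  ultimately have "compact M" by (simp add: compact_eq_bounded_closed)
  obtain A0 where A0_rows: "\<And>i. A0 $ i \<in> S" and detA0: "det A0 \<noteq> 0"
    using invertible_matrix_with_rows_in[OF span] by blast
  then have A0: "A0 \<in> M" by (simp add: M_def)
  have "continuous_on M (\<lambda>A. cmod (det A))"
    unfolding det_def by (intro continuous_intros)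
  then obtain A where A: "A \<in> M" "\<And>A'. A' \<in> M \<Longrightarrow> cmod (det A') \<le> cmod (det A)"
    using continuous_attains_sup[OF \<open>compact M\<close>] A0 by blast
  show thesis
  proof (rule that[of A])
    show "det A \<noteq> 0" using A(2)[OF A0] detA0 by auto
  qed (use A in \<open>auto simp: M_def\<close>)
qed

text \<open>
  Choose \<open>n\<close> functionals in the dual complement of \<open>D - p\<close> with largest possible determinant and use
  them as coordinates. No coordinate takes the value 1, by the choice of the functionals. By Cramer's
  rule and maximality, every other functional of the dual complement has coefficients of modulus at
  most 1 with respect to the chosen ones. Now let \<open>q\<close> be a point of the complement nearest to the
  origin. Its tangent functional has the coefficients \<open>cnj (q $ i) / (norm q)\<^sup>2\<close>, and
  if all of these are at most 1 in modulus then \<open>norm q \<ge> 1 / sqrt n\<close>.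
\<close>
lemma C_convex_normal_position:
  fixes D :: "(complex ^ 'n) set"
  assumes D: "C_convex_domain D" and nd: "\<not> degenerate D" and p: "p \<in> D"
  obtains A B :: "complex ^ 'n ^ 'n" where "A ** B = mat 1"
    "ball 0 (1 / sqrt CARD('n)) \<subseteq> {w. p + B *v w \<in> D}"
    "\<And>w i. p + B *v w \<in> D \<Longrightarrow> w $ i \<noteq> 1"
proof -
  define E where "E = {w. p + w \<in> D}"
  have E: "C_convex_domain E"
    using C_convex_affine_preimage[OF D, of "mat 1" "mat 1" p] by (simp add: E_def)
  have E0: "0 \<in> E" using p by (simp add: E_def)
  have oE: "open E" using E by (simp add: C_convex_domain_def is_domain_def)
  have ndE: "\<not> degenerate E"
  proof
    assume "degenerate E"
    then obtain a v where v: "v \<noteq> 0" "{a + t *s v | t. True} \<subseteq> E"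
      by (auto simp: degenerate_def complex_line_def)
    have "{(p + a) + t *s v | t. True} \<subseteq> D"
      using v(2) by (auto simp: E_def add.assoc subset_iff)
    moreover have "complex_line {(p + a) + t *s v | t. True}"
      using v(1) unfolding complex_line_def by blast
    ultimately show False using nd by (auto simp: degenerate_def)
  qed
  obtain A where A: "\<And>i. A $ i \<in> dual_complement E" "det A \<noteq> 0"
    "\<And>A'. (\<And>i. A' $ i \<in> dual_complement E) \<Longrightarrow> cmod (det A') \<le> cmod (det A)"
    using maximal_determinant_matrix[OF compact_dual_complement[OF oE E0]
        span_dual_complement[OF E E0 ndE]] by metis
  obtain B where AB: "A ** B = mat 1" and BA: "B ** A = mat 1"
    using A(2) invertible_det_nz[of A] by (auto simp: invertible_def)
  define G where "G = {w. B *v w \<in> E}"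
  have G_eq: "G = {w. p + B *v w \<in> D}" by (simp add: G_def E_def)
  have G: "C_convex_domain G"
    using C_convex_affine_preimage[OF E BA, of 0] by (simp add: G_def)
  have coord: "w $ i \<noteq> 1" if "w \<in> G" for w i
  proof -
    have "w = A *v (B *v w)" by (simp add: matrix_vector_mul_assoc AB)
    then have "w $ i = bdot (A $ i) (B *v w)" by (metis matrix_vector_mult_component_bdot)
    then show ?thesis using A(1)[of i] that by (auto simp: dual_complement_def G_def)
  qed
  have "ball 0 (1 / sqrt CARD('n)) \<subseteq> G"
  proof (rule ccontr)
    assume "\<not> ?thesis"
    moreover have "0 \<in> G" using E0 by (simp add: G_def)
    ultimately obtain q where q: "q \<noteq> 0" "norm q < 1 / sqrt CARD('n)"
      "\<And>z. z \<in> G \<Longrightarrow> hinner z q \<noteq> (norm q)\<^sup>2"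
      using C_convex_nearest_point_hyperplane[OF G] by metis
    define x where "x = (\<chi> i. cnj (q $ i) / of_real ((norm q)\<^sup>2))"
    define l where "l = (\<Sum>i\<in>UNIV. x $ i *s A $ i)"
    have l: "bdot l z = hinner (A *v z) q / (norm q)\<^sup>2" for z
    proof -
      have "l = (\<Sum>i\<in>UNIV. cnj ((of_real (1 / (norm q)\<^sup>2) *s q) $ i) *s A $ i)"
        by (simp add: l_def x_def)
      then show ?thesis
        by (simp only: hinner_matrix_vector_mult[symmetric] hinner_simps) simp
    qed
    have l_dual: "l \<in> dual_complement E"
      unfolding dual_complement_def
    proof (intro CollectI ballI)
      fix z assume "z \<in> E"
      then have "A *v z \<in> G" by (simp add: G_def matrix_vector_mul_assoc BA)
      then show "bdot l z \<noteq> 1" using q(1,3) by (auto simp: l)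
    qed
    have row: "row i A = A $ i" for i by (simp add: row_def)
    have x_le: "cmod (x $ k) \<le> 1" for k
    proof -
      have "cmod (det (\<chi> i. if i = k then l else A $ i)) \<le> cmod (det A)"
        by (rule A(3)) (use l_dual A(1) in auto)
      moreover have "det (\<chi> i. if i = k then l else A $ i) = x $ k * det A"
        using cramer_lemma_transpose[of k x A] unfolding l_def row by simp
      ultimately show ?thesis using A(2) by (simp add: norm_mult)
    qed
    have "cmod (q $ k) \<le> (norm q)\<^sup>2" for k
      using x_le[of k] q(1) by (simp add: x_def norm_divide norm_power divide_le_eq)
    then have "(\<Sum>k\<in>UNIV. (cmod (q $ k))\<^sup>2) \<le> (\<Sum>k\<in>(UNIV :: 'n set). ((norm q)\<^sup>2)\<^sup>2)"
      by (intro sum_mono power_mono) auto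
    then have "(norm q)\<^sup>2 \<le> real CARD('n) * ((norm q)\<^sup>2)\<^sup>2"
      by (simp add: norm_vec_def L2_set_def sum_nonneg)
    then have "1 \<le> real CARD('n) * (norm q)\<^sup>2"
      using q(1) by (simp add: power2_eq_square)
    moreover have "(norm q)\<^sup>2 < (1 / sqrt CARD('n))\<^sup>2"
      using q(2) by (intro power_strict_mono) auto
    then have "real CARD('n) * (norm q)\<^sup>2 < 1"
      by (simp add: power_divide field_simps)
    ultimately show False by simp
  qed
  then show thesis
    using that[OF AB] coord by (simp add: G_eq)
qed

section \<open>Square roots of the coordinate functions\<close>

lemma norm_axis_complex: "norm (axis i a :: complex ^ 'n) = cmod a"
  unfolding norm_vec_def L2_set_def axis_def
  by (simp add: if_distrib[of "\<lambda>x. (cmod x)\<^sup>2"] cong: if_cong)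

text \<open>
  The root comes from a logarithm along the lines through the origin. It is a function of the
  coordinate \<open>w $ i\<close> alone: two points of \<open>D\<close> with the same coordinate lie on a line on which the
  coordinate is constant, and the slice of \<open>D\<close> by this line is connected. If \<open>g\<close> is close to
  \<open>-1\<close> at a point of \<open>D\<close>, the coordinate is close to 0 there and the same value of it occurs in the ball,
  where \<open>g\<close> is the principal branch and close to 1. This contradiction shows that \<open>g\<close> omits a disc
  about \<open>-1\<close>, which makes \<open>1 / (g + 1)\<close> bounded.
\<close>
lemma square_root_branch:
  fixes D :: "(complex ^ 'n) set"
  assumes D: "C_convex_domain D" and r: "0 < r" "r \<le> 1" and ball: "ball 0 r \<subseteq> D"
    and ne1: "\<And>w. w \<in> D \<Longrightarrow> w $ i \<noteq> 1"
  obtains g where "continuous_on D g" "\<And>w. w \<in> D \<Longrightarrow> (g w)\<^sup>2 = 1 - w $ i"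
    "\<And>w. w \<in> ball 0 r \<Longrightarrow> 0 < Re (g w)" "\<And>w. w \<in> D \<Longrightarrow> r / 3 \<le> cmod (g w + 1)" "g 0 = 1"
proof -
  have D0: "0 \<in> D" using ball r by auto
  have "\<exists>c. continuous_on D c \<and> (\<forall>w\<in>D. exp (c w) = (1 - w $ i) / (1 - (0 :: complex ^ 'n) $ i))"
  proof (rule continuous_log_of_ratio_along_lines[OF D])
    show "continuous_on UNIV (\<lambda>z :: complex ^ 'n. 1 - z $ i)" by (intro continuous_intros)
    show "1 - (0 + t *s (w - 0)) $ i \<noteq> 0" if "0 + t *s (w - 0) \<in> D" for w t
      using ne1[OF that] by simp
  qed (use D0 in \<open>auto intro: continuous_intros\<close>)
  then obtain c where c: "continuous_on D c" "\<And>w. w \<in> D \<Longrightarrow> exp (c w) = 1 - w $ i"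
    by auto
  \<comment> \<open>Subtracting \<open>c 0\<close> selects the branch with value 1 at the origin.\<close>
  define g where "g = (\<lambda>w. exp ((c w - c 0) / 2))"
  have g_cont: "continuous_on D g"
    unfolding g_def by (intro continuous_intros c(1)) auto
  have g_sq: "(g w)\<^sup>2 = 1 - w $ i" if "w \<in> D" for w
  proof -
    have "(g w)\<^sup>2 = exp (c w - c 0)" by (simp add: g_def power2_eq_square flip: exp_add)
    then show ?thesis using c(2)[OF that] c(2)[OF D0] by (simp add: exp_diff)
  qed
  have g0: "g 0 = 1" by (simp add: g_def)
  have Re_pos: "0 < Re (g w)" if w: "w \<in> ball 0 r" for w
  proof (rule ccontr)
    assume neg: "\<not> 0 < Re (g w)"
    have con: "connected ((\<lambda>w. Re (g w)) ` ball 0 r)"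
      by (intro connected_continuous_image continuous_intros continuous_on_subset[OF g_cont ball] connected_ball)
    have w_mem: "Re (g w) \<in> (\<lambda>w. Re (g w)) ` ball 0 r" using w by blast
    have one_mem: "1 \<in> (\<lambda>w. Re (g w)) ` ball 0 r"
      using r g0 by (intro image_eqI[of _ _ 0]) simp_all
    have "0 \<in> (\<lambda>w. Re (g w)) ` ball 0 r"
      by (rule connectedD_interval[OF con w_mem one_mem]) (use neg in simp_all)
    then obtain z where z: "z \<in> ball 0 r" "Re (g z) = 0" by auto
    have "cmod (z $ i) < 1" using z(1) r Finite_Cartesian_Product.norm_nth_le[of z i] by simp
    then have "Re (z $ i) < 1" using complex_Re_le_cmod[of "z $ i"] by linarith
    moreover have "Re ((g z)\<^sup>2) = Re (1 - z $ i)" using g_sq z(1) ball by auto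
    ultimately show False using z(2) zero_le_square[of "Im (g z)"] by (simp add: power2_eq_square)
  qed
  have fibre: "g w' = g w" if w: "w \<in> D" "w' \<in> D" "w' $ i = w $ i" for w w'
  proof (cases "w' = w")
    case False
    define U where "U = {t. w + t *s (w' - w) \<in> D}"
    have cU: "connected U"
      using C_convex_slice(2)[OF D, of "w' - w" w] False by (simp add: U_def)
    have gU: "(g (w + t *s (w' - w)))\<^sup>2 = (g w)\<^sup>2" if "t \<in> U" for t
      using that g_sq[of "w + t *s (w' - w)"] g_sq[OF w(1)] w(3) by (simp add: U_def)
    have "(\<lambda>t. g (w + t *s (w' - w))) constant_on U"
    proof (rule continuous_finite_range_constant[OF cU])
      show "continuous_on U (\<lambda>t. g (w + t *s (w' - w)))"
        by (intro continuous_on_compose2[OF g_cont] continuous_intros) (auto simp: U_def)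
      show "finite ((\<lambda>t. g (w + t *s (w' - w))) ` U)"
        by (rule finite_subset[of _ "{g w, - g w}"]) (use gU power2_eq_iff in auto)
    qed
    moreover have "0 \<in> U" "1 \<in> U" using w by (auto simp: U_def)
    ultimately have "g (w + 1 *s (w' - w)) = g (w + 0 *s (w' - w))"
      unfolding constant_on_def by metis
    then show ?thesis by simp
  qed simp
  have "r / 3 \<le> cmod (g w + 1)" if w: "w \<in> D" for w
  proof (rule ccontr)
    assume "\<not> ?thesis"
    then have small: "cmod (g w + 1) < r / 3" by simp
    have "cmod (1 - g w) \<le> cmod 2 + cmod (g w + 1)"
      using norm_triangle_ineq4[of 2 "g w + 1"] by (simp add: algebra_simps)
    then have le: "cmod (1 - g w) \<le> 2 + 1 / 3" using small r by simp
    \<comment> \<open>The coordinate \<open>w $ i\<close> is then so small that it is also attained inside the ball, where the real part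
      of \<open>g\<close> is positive.\<close>
    have "w $ i = (1 - g w) * (g w + 1)"
      using g_sq[OF w] by (simp add: power2_eq_square algebra_simps)
    then have "cmod (w $ i) = cmod (1 - g w) * cmod (g w + 1)" by (simp add: norm_mult)
    also have "\<dots> \<le> (2 + 1 / 3) * (r / 3)"
      using le small by (intro mult_mono) auto
    also have "\<dots> < r" using r by simp
    finally have "axis i (w $ i) \<in> ball 0 r" by (simp add: norm_axis_complex)
    moreover from this have "g (axis i (w $ i)) = g w"
      using ball by (intro fibre[OF w]) (auto simp: axis_def)
    ultimately have "0 < Re (g w)" using Re_pos by metis
    moreover have "\<bar>Re (g w + 1)\<bar> < r / 3"
      using small abs_Re_le_cmod[of "g w + 1"] by linarith
    ultimately show False using r by simp
  qed
  then show thesis using that g_cont g_sq Re_pos g0 by blast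
qed

text \<open>
  Near \<open>z\<close> the quotient \<open>g w / g z\<close> has positive real part, so it is the principal square root of its
  square.
\<close>
lemma has_derivative_square_root_branch:
  fixes D :: "(complex ^ 'n) set"
  assumes "open D" and g: "continuous_on D g" and sq: "\<And>w. w \<in> D \<Longrightarrow> (g w)\<^sup>2 = 1 - w $ i"
    and z: "z \<in> D" and nz: "g z \<noteq> 0"
  shows "(g has_derivative (\<lambda>v. - (v $ i) / (2 * g z))) (at z)"
proof -
  define k where "k = (\<lambda>w. g z * csqrt ((1 - w $ i) / (g z)\<^sup>2))"
  have z1: "(1 - z $ i) / (g z)\<^sup>2 = 1" unfolding sq[OF z, symmetric] using nz by simp
  have c: "(csqrt has_derivative (*) (1 / 2)) (at ((1 - z $ i) / (g z)\<^sup>2))"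
    unfolding z1 using has_field_derivative_csqrt[of 1]
    by (simp add: has_field_derivative_def inverse_eq_divide)
  have l: "((\<lambda>w. (1 - w $ i) / (g z)\<^sup>2) has_derivative (\<lambda>v. - (v $ i) / (g z)\<^sup>2)) (at z)"
    by (auto intro!: derivative_eq_intros bounded_linear.has_derivative[OF bounded_linear_vec_nth]
        simp: nz fun_eq_iff power_numeral_reduce)
  have "(k has_derivative (\<lambda>v. g z * ((1 / 2) * (- (v $ i) / (g z)\<^sup>2)))) (at z)"
    unfolding k_def using has_derivative_compose[OF l c] by (rule has_derivative_mult_right)
  moreover have "(\<lambda>v. g z * ((1 / 2) * (- (v $ i) / (g z)\<^sup>2))) = (\<lambda>v. - (v $ i) / (2 * g z))"
    using nz by (simp add: fun_eq_iff power2_eq_square)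
  ultimately have k: "(k has_derivative (\<lambda>v. - (v $ i) / (2 * g z))) (at z)" by simp
  have "isCont g z" using g \<open>open D\<close> z continuous_on_eq_continuous_at by blast
  then have "((\<lambda>w. Re (g w / g z)) \<longlongrightarrow> Re (g z / g z)) (at z)"
    using nz by (intro tendsto_intros) (auto simp: isCont_def)
  then have "\<forall>\<^sub>F w in at z. 0 < Re (g w / g z)"
    using nz by (intro order_tendstoD(1)) auto
  moreover have "\<forall>\<^sub>F w in at z. w \<in> D"
    using \<open>open D\<close> z by (rule eventually_at_in_open')
  ultimately have "\<forall>\<^sub>F w in at z. k w = g w"
  proof eventually_elim
    case (elim w)
    have "csqrt ((1 - w $ i) / (g z)\<^sup>2) = g w / g z"
      using elim by (intro csqrt_unique) (auto simp: power_divide sq)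
    then show ?case using nz by (simp add: k_def)
  qed
  moreover have "k z = g z" by (simp add: k_def z1)
  ultimately show ?thesis
    using has_derivative_transform_eventually[OF k] by auto
qed

section \<open>The embedding into the ball\<close>

lemma norm_less_of_components:
  fixes x :: "complex ^ 'n"
  assumes "\<And>i. cmod (x $ i) < b / sqrt CARD('n)"
  shows "norm x < b"
proof -
  have pos: "0 < b / sqrt CARD('n)" using assms norm_ge_zero le_less_trans by blast
  then have b: "b > 0" by (simp add: zero_less_divide_iff)
  have "(norm x)\<^sup>2 = (\<Sum>i\<in>UNIV. (cmod (x $ i))\<^sup>2)"
    by (simp add: norm_vec_def L2_set_def sum_nonneg)
  also have "\<dots> < (\<Sum>i\<in>(UNIV :: 'n set). (b / sqrt CARD('n))\<^sup>2)"
    using assms by (intro sum_strict_mono power_strict_mono) auto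
  also have "\<dots> = b\<^sup>2" by (simp add: power_divide)
  finally show ?thesis using b power_less_imp_less_base by fastforce
qed

lemma has_derivative_vec_componentwise:
  fixes h :: "'n::finite \<Rightarrow> 'a::real_normed_vector \<Rightarrow> complex"
  assumes "\<And>i. (h i has_derivative h' i) (at z)"
  shows "((\<lambda>w. \<chi> i. h i w) has_derivative (\<lambda>v. \<chi> i. h' i v)) (at z)"
  unfolding has_derivative_componentwise_within[of "\<lambda>w. \<chi> i. h i w"]
  by (auto simp: Basis_vec_def inner_axis intro!: has_derivative_inner_left assms)

text \<open>
  The map with components \<open>\<kappa> * (1 / (g i w + 1) - 1 / 2)\<close>, where \<open>g i\<close> is the square root of \<open>1 - w $ i\<close>
  from \<open>square_root_branch\<close>. It is injective because \<open>g i w\<close> determines \<open>w $ i\<close>, and its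
  derivative is diagonal with non-vanishing entries \<open>\<mu> w i\<close>. With \<open>r = 1 / sqrt n\<close>, the bound \<open>r / 3\<close> for \<open>\<bar>g i w + 1\<bar>\<close>
  shows that \<open>\<kappa> = r\<^sup>2 / 6\<close> keeps every component below \<open>r\<close>, hence the image in the unit ball. Conversely, a
  small \<open>y\<close> is attained at the point with coordinates \<open>1 - u\<^sup>2\<close>, where \<open>u\<close> is obtained from \<open>y\<close> by
  inverting the Moebius transformation; the constant \<open>144\<close> guarantees that this point lies in the
  ball of radius \<open>r\<close>, where \<open>g i\<close> is the principal root and so equals \<open>u i\<close>.
\<close>
lemma normal_position_embedding:
  fixes E :: "(complex ^ 'n) set"
  defines "r \<equiv> 1 / sqrt (real CARD('n))"
  assumes E: "C_convex_domain E" and ball: "ball 0 r \<subseteq> E" and ne1: "\<And>w i. w \<in> E \<Longrightarrow> w $ i \<noteq> 1"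
  obtains F G :: "complex ^ 'n \<Rightarrow> complex ^ 'n" and \<mu> :: "complex ^ 'n \<Rightarrow> 'n \<Rightarrow> complex"
  where "\<And>w. w \<in> E \<Longrightarrow> (F has_derivative (\<lambda>v. \<chi> i. \<mu> w i * v $ i)) (at w)"
    "\<And>w i. w \<in> E \<Longrightarrow> \<mu> w i \<noteq> 0" "F ` E \<subseteq> ball 0 1" "F 0 = 0"
    "\<And>w. w \<in> E \<Longrightarrow> G (F w) = w" "continuous_on (F ` E) G" "ball 0 (r ^ 4 / 144) \<subseteq> F ` E"
proof -
  have n1: "1 \<le> real CARD('n)" by (simp add: Suc_leI)
  have r: "0 < r" "r \<le> 1" using n1 by (auto simp: r_def)
  have r2: "r\<^sup>2 \<le> 1" using r by (simp add: power_le_one)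
  have "\<exists>g. continuous_on E g \<and> (\<forall>w\<in>E. (g w)\<^sup>2 = 1 - w $ i) \<and> (\<forall>w\<in>ball 0 r. 0 < Re (g w))
      \<and> (\<forall>w\<in>E. r / 3 \<le> cmod (g w + 1)) \<and> g 0 = 1" for i
    by (rule square_root_branch[OF E r ball ne1[of _ i]]) (assumption, blast)
  then obtain g where g: "\<And>i. continuous_on E (g i)" "\<And>i w. w \<in> E \<Longrightarrow> (g i w)\<^sup>2 = 1 - w $ i"
    "\<And>i w. w \<in> ball 0 r \<Longrightarrow> 0 < Re (g i w)" "\<And>i w. w \<in> E \<Longrightarrow> r / 3 \<le> cmod (g i w + 1)"
    "\<And>i. g i 0 = 1"
    by metis
  define \<kappa> where "\<kappa> = complex_of_real (r\<^sup>2 / 6)"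
  define F where "F = (\<lambda>w. \<chi> i. \<kappa> * (1 / (g i w + 1) - 1 / 2))"
  define G :: "complex ^ 'n \<Rightarrow> complex ^ 'n" where
    "G = (\<lambda>y. \<chi> i. 1 - (1 / (y $ i / \<kappa> + 1 / 2) - 1)\<^sup>2)"
  define \<mu> where "\<mu> = (\<lambda>w i. \<kappa> / (2 * g i w * (g i w + 1)\<^sup>2))"
  have \<kappa>: "\<kappa> \<noteq> 0" "cmod \<kappa> = r\<^sup>2 / 6" using r by (auto simp: \<kappa>_def norm_power)
  have oE: "open E" using E by (simp add: C_convex_domain_def is_domain_def)
  have g_nz: "g i w \<noteq> 0" "g i w + 1 \<noteq> 0" if "w \<in> E" for i w
    using g(2,4)[OF that, of i] ne1[OF that, of i] r by auto
  have dg: "((\<lambda>w. g i w) has_derivative (\<lambda>v. - (v $ i) / (2 * g i w))) (at w)" if "w \<in> E" for i w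
    using has_derivative_square_root_branch[OF oE g(1,2) that g_nz(1)[OF that]] by simp
  show thesis
  proof (rule that[of F \<mu> G])
    fix w assume w: "w \<in> E"
    show "(F has_derivative (\<lambda>v. \<chi> i. \<mu> w i * v $ i)) (at w)"
      unfolding F_def
    proof (rule has_derivative_vec_componentwise)
      fix i
      show "((\<lambda>w. \<kappa> * (1 / (g i w + 1) - 1 / 2)) has_derivative (\<lambda>v. \<mu> w i * v $ i)) (at w)"
        by (rule derivative_eq_intros dg[OF w] refl g_nz[OF w])+
          (use g_nz[OF w] in \<open>auto simp: fun_eq_iff \<mu>_def power2_eq_square\<close>)
    qed
    show "\<mu> w i \<noteq> 0" for i using g_nz[OF w] \<kappa> by (simp add: \<mu>_def)
    show "G (F w) = w"
      using g_nz[OF w] \<kappa> g(2)[OF w] by (simp add: vec_eq_iff G_def F_def)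
  next
    show "F ` E \<subseteq> ball 0 1"
    proof
      fix y assume "y \<in> F ` E"
      then obtain w where w: "w \<in> E" "y = F w" by auto
      have "cmod (y $ i) < 1 / sqrt CARD('n)" for i
      proof -
        have "cmod (1 / (g i w + 1)) \<le> 3 / r"
          using g(4)[OF w(1), of i] r g_nz(2)[OF w(1), of i] by (simp add: norm_divide field_simps)
        then have "cmod (1 / (g i w + 1) - 1 / 2) \<le> 3 / r + 1 / 2"
          using norm_triangle_ineq4[of "1 / (g i w + 1)" "1 / 2"] by simp
        then have "cmod (y $ i) \<le> r\<^sup>2 / 6 * (3 / r + 1 / 2)"
          using r by (simp add: w(2) F_def norm_mult \<kappa>(2) mult_left_mono)
        also have "\<dots> = r * (1 / 2 + r / 12)" using r by (simp add: power2_eq_square field_simps)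
        also have "\<dots> < r * 1" using r by (intro mult_strict_left_mono) auto
        finally show ?thesis by (simp add: r_def)
      qed
      then show "y \<in> ball 0 1" using norm_less_of_components[of y 1] by simp
    qed
    show "F 0 = 0" by (simp add: F_def g(5) vec_eq_iff)
    have "y $ i / \<kappa> + 1 / 2 \<noteq> 0" if "y \<in> F ` E" for y i
      using that g_nz \<kappa> by (auto simp: F_def)
    then show "continuous_on (F ` E) G"
      unfolding G_def by (intro continuous_intros) (auto simp: \<kappa>)
    show "ball 0 (r ^ 4 / 144) \<subseteq> F ` E"
    proof
      fix y :: "complex ^ 'n" assume y: "y \<in> ball 0 (r ^ 4 / 144)"
      define \<eta> where "\<eta> = (\<lambda>i. y $ i / \<kappa>)"
      define u where "u = (\<lambda>i. 1 / (\<eta> i + 1 / 2) - 1)"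
      define w where "w = (\<chi> i. 1 - (u i)\<^sup>2)"
      have \<eta>: "cmod (\<eta> i) < r\<^sup>2 / 24" for i
      proof -
        have "cmod (y $ i) < r ^ 4 / 144"
          using y Finite_Cartesian_Product.norm_nth_le[of y i] by simp
        then have "cmod (y $ i) / (r\<^sup>2 / 6) < r ^ 4 / 144 / (r\<^sup>2 / 6)"
          using r by (intro divide_strict_right_mono) auto
        also have "\<dots> = r\<^sup>2 / 24" using r by (simp add: power_numeral_reduce)
        finally show ?thesis by (simp add: \<eta>_def norm_divide \<kappa>(2))
      qed
      have den: "1 / 4 \<le> cmod (\<eta> i + 1 / 2)" for i
        using norm_triangle_ineq2[of "1 / 2" "- \<eta> i"] \<eta>[of i] r2 by (simp add: add.commute)
      then have den0: "\<eta> i + 1 / 2 \<noteq> 0" for i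
        using den[of i] by (metis norm_zero not_le zero_less_divide_1_iff zero_less_numeral)
      have u: "cmod (u i - 1) < r\<^sup>2 / 3" for i
      proof -
        have "u i - 1 = - (2 * \<eta> i) / (\<eta> i + 1 / 2)"
          using den0[of i] by (simp add: u_def field_simps)
        then have "cmod (u i - 1) = 2 * cmod (\<eta> i) / cmod (\<eta> i + 1 / 2)"
          by (simp add: norm_divide norm_mult)
        also have "\<dots> \<le> 2 * cmod (\<eta> i) / (1 / 4)"
          using den[of i] by (intro divide_left_mono) (auto intro: mult_pos_pos)
        also have "\<dots> < r\<^sup>2 / 3" using \<eta>[of i] by simp
        finally show ?thesis .
      qed
      have "cmod (w $ i) < r / sqrt CARD('n)" for i
      proof -
        have "cmod (u i + 1) \<le> cmod (u i - 1) + 2"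
          using norm_triangle_ineq[of "u i - 1" 2] by (simp add: add.commute)
        then have "cmod (u i + 1) \<le> 2 + 1 / 3" using u[of i] r2 by simp
        moreover have "w $ i = - ((u i + 1) * (u i - 1))"
          by (simp add: w_def power2_eq_square algebra_simps)
        then have "cmod (w $ i) = cmod (u i + 1) * cmod (u i - 1)" by (simp add: norm_mult)
        ultimately have "cmod (w $ i) \<le> (2 + 1 / 3) * (r\<^sup>2 / 3)"
          using u[of i] by (simp only:) (intro mult_mono; simp)
        also have "\<dots> < r\<^sup>2" using r by simp
        also have "r\<^sup>2 = r / sqrt CARD('n)" by (simp add: r_def power2_eq_square)
        finally show ?thesis .
      qed
      then have wr: "w \<in> ball 0 r" using norm_less_of_components[of w r] by simp
      have "g i w = u i" for i
      proof -
        have "(g i w)\<^sup>2 = (u i)\<^sup>2" using g(2)[of w i] wr ball by (auto simp: w_def)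
        then have "g i w = u i \<or> g i w = - u i" by (simp add: power2_eq_iff)
        moreover have "0 < Re (u i)"
        proof -
          have "\<bar>Re (u i - 1)\<bar> < r\<^sup>2 / 3" using u[of i] abs_Re_le_cmod le_less_trans by blast
          then have "\<bar>Re (u i) - 1\<bar> < r\<^sup>2 / 3" by simp
          then show ?thesis using r2 by linarith
        qed
        ultimately show ?thesis using g(3)[OF wr, of i] by auto
      qed
      then have "F w = y"
        using den0 \<kappa>(1) by (simp add: F_def vec_eq_iff u_def \<eta>_def)
      then show "y \<in> F ` E" using wr ball by blast
    qed
  qed
qed

text \<open>
  Transports an embedding from normal position back to the original domain; the factors \<open>\<mu>\<close> make the
  derivative a complex matrix, invertible like \<open>A\<close>.
\<close>
lemma centred_embeddingsI:
  fixes D :: "(complex ^ 'n) set" and A B :: "complex ^ 'n ^ 'n" and p :: "complex ^ 'n"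
  defines "E \<equiv> {w. p + B *v w \<in> D}"
  assumes AB: "A ** B = mat 1"
    and dF: "\<And>w. w \<in> E \<Longrightarrow> (F has_derivative (\<lambda>v. \<chi> i. \<mu> w i * v $ i)) (at w)"
    and \<mu>: "\<And>w i. w \<in> E \<Longrightarrow> \<mu> w i \<noteq> 0"
    and F: "F ` E \<subseteq> ball 0 1" "F 0 = 0" and G: "\<And>w. w \<in> E \<Longrightarrow> G (F w) = w" "continuous_on (F ` E) G"
  obtains f where "f \<in> centred_embeddings D p" "f ` D = F ` E"
proof -
  define f where "f = (\<lambda>z. F (A *v (z - p)))"
  have BA: "B ** A = mat 1" using AB matrix_left_right_inverse by blast
  have BAz: "p + B *v (A *v (z - p)) = z" for z
    by (simp add: matrix_vector_mul_assoc BA)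
  have ABw: "A *v (p + B *v w - p) = w" for w
    by (simp add: matrix_vector_mul_assoc AB)
  have inE: "A *v (z - p) \<in> E \<longleftrightarrow> z \<in> D" for z by (simp add: E_def BAz)
  have image: "f ` D = F ` E"
  proof
    show "f ` D \<subseteq> F ` E" using inE by (auto simp: f_def)
    show "F ` E \<subseteq> f ` D"
    proof
      fix y assume "y \<in> F ` E"
      then obtain w where w: "w \<in> E" "y = F w" by auto
      then have "p + B *v w \<in> D" "y = f (p + B *v w)" by (simp_all only: f_def ABw E_def mem_Collect_eq)
      then show "y \<in> f ` D" by blast
    qed
  qed
  have df: "(f has_derivative (\<lambda>v. \<chi> i. \<mu> (A *v (z - p)) i * (A *v v) $ i)) (at z)" if "z \<in> D" for z
  proof -
    have "((\<lambda>z. A *v (z - p)) has_derivative (\<lambda>v. A *v v)) (at z)"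
      by (rule bounded_linear.has_derivative[OF matrix_vector_mul_bounded_linear])
        (auto intro!: derivative_eq_intros)
    then show ?thesis
      unfolding f_def by (rule has_derivative_compose[of _ _ _ _ F]) (use dF inE that in auto)
  qed
  have "holomorphic_map_on f D"
    unfolding holomorphic_map_on_def
  proof
    fix z assume z: "z \<in> D"
    have "(\<lambda>v. \<chi> i. \<mu> (A *v (z - p)) i * (A *v v) $ i) = (*v) (\<chi> i j. \<mu> (A *v (z - p)) i * A $ i $ j)"
      by (simp add: fun_eq_iff vec_eq_iff matrix_vector_mult_def sum_distrib_left mult.assoc)
    then have "Vector_Spaces.linear (*s) (*s) (\<lambda>v. \<chi> i. \<mu> (A *v (z - p)) i * (A *v v) $ i)"
      by (simp only: matrix_vector_mul_linear_gen)
    then show "\<exists>L. (f has_derivative L) (at z) \<and> Vector_Spaces.linear (*s) (*s) L"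
      using df[OF z] by blast
  qed
  moreover have "inj (frechet_derivative f (at z))" if z: "z \<in> D" for z
  proof -
    have "inj (\<lambda>v. \<chi> i. \<mu> (A *v (z - p)) i * (A *v v) $ i)"
    proof (rule injI)
      fix v v' assume "(\<chi> i. \<mu> (A *v (z - p)) i * (A *v v) $ i) = (\<chi> i. \<mu> (A *v (z - p)) i * (A *v v') $ i)"
      then have "A *v v = A *v v'" using \<mu> inE z by (simp add: vec_eq_iff)
      then have "B *v (A *v v) = B *v (A *v v')" by simp
      then show "v = v'" by (simp add: matrix_vector_mul_assoc BA)
    qed
    then show ?thesis using frechet_derivative_at[OF df[OF z]] by simp
  qed
  moreover have "homeomorphism D (f ` D) f (\<lambda>y. p + B *v G y)"
  proof (rule homeomorphismI)
    show "continuous_on D f"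
      using df has_derivative_continuous continuous_at_imp_continuous_on by blast
    show "continuous_on (f ` D) (\<lambda>y. p + B *v G y)"
      unfolding image
      by (intro continuous_intros continuous_on_compose2[OF linear_continuous_on[OF matrix_vector_mul_bounded_linear, of UNIV B] G(2)]) auto
    show inv: "p + B *v G (f z) = z" if "z \<in> D" for z
      using G(1) inE that by (simp add: f_def BAz)
    then show "(\<lambda>y. p + B *v G y) ` f ` D \<subseteq> D" by auto
    show "f (p + B *v G y) = y" if "y \<in> f ` D" for y
      using that inv by auto
  qed auto
  ultimately have "f \<in> centred_embeddings D p"
    using F image by (auto simp: centred_embeddings_def holomorphic_embedding_def f_def)
  with image show thesis using that by blast
qed

text \<open>
  Since both suprema are over sets bounded above, a single embedding whose image contains a ball
  gives a lower bound.
\<close>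
lemma squeezing_function_ge:
  fixes D :: "(complex ^ 'n) set"
  assumes f: "f \<in> centred_embeddings D p" and c: "c > 0" "ball 0 c \<subseteq> f ` D"
  shows "c \<le> squeezing_function D p"
proof -
  have le1: "r \<le> 1" if h: "h \<in> centred_embeddings D p" and r: "r \<in> {r. r > 0 \<and> ball 0 r \<subseteq> h ` D}" for h r
  proof -
    have "h ` D \<subseteq> ball 0 1"
      using h by (simp add: centred_embeddings_def holomorphic_embedding_def)
    moreover have "ball 0 r \<subseteq> h ` D" using r by simp
    ultimately have "ball 0 r \<subseteq> ball (0 :: complex ^ 'n) 1" by blast
    then show ?thesis using r by (simp add: ball_subset_ball_iff)
  qed
  have bdd: "bdd_above {r. r > 0 \<and> ball 0 r \<subseteq> h ` D}" if "h \<in> centred_embeddings D p" for h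
    using le1[OF that] by (intro bdd_aboveI) auto
  have "c \<le> squeezing_at D f"
    unfolding squeezing_at_def using c bdd[OF f] by (intro cSup_upper) auto
  also have "squeezing_at D f \<le> Sup (squeezing_at D ` centred_embeddings D p)"
  proof (rule cSup_upper)
    \<comment> \<open>The unspecified real number \<open>Sup {}\<close> covers the case of an image that contains no ball about 0.\<close>
    have "squeezing_at D h \<le> max 1 (Sup {})" if "h \<in> centred_embeddings D p" for h
    proof (cases "{r. r > 0 \<and> ball 0 r \<subseteq> h ` D} = {}")
      case False
      then have "squeezing_at D h \<le> 1"
        unfolding squeezing_at_def using le1[OF that] by (intro cSup_least) auto
      then show ?thesis by simp
    qed (simp only: squeezing_at_def max.cobounded2)
    then show "bdd_above (squeezing_at D ` centred_embeddings D p)"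
      by (intro bdd_aboveI[of _ "max 1 (Sup {})"]) auto
  qed (use f in auto)
  finally show ?thesis using f by (auto simp: squeezing_function_def)
qed

theorem theorem1:
  shows "\<exists>c::real. c > 0 \<and>
    (\<forall>D :: (complex ^ 'n::finite) set.
       C_convex_domain D \<and> \<not> degenerate D \<longrightarrow> (\<forall>p\<in>D. squeezing_function D p \<ge> c))"
proof (intro exI conjI allI impI ballI)
  show "0 < (1 / sqrt (real CARD('n))) ^ 4 / 144" by simp
  fix D :: "(complex ^ 'n) set" and p
  assume D: "C_convex_domain D \<and> \<not> degenerate D" and p: "p \<in> D"
  obtain A B :: "complex ^ 'n ^ 'n" where AB: "A ** B = mat 1"
    and ball: "ball 0 (1 / sqrt CARD('n)) \<subseteq> {w. p + B *v w \<in> D}"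
    and ne1: "\<And>w i. p + B *v w \<in> D \<Longrightarrow> w $ i \<noteq> 1"
    using C_convex_normal_position D p by metis
  have "B ** A = mat 1" using AB matrix_left_right_inverse by blast
  then have E: "C_convex_domain {w. p + B *v w \<in> D}"
    using C_convex_affine_preimage D by blast
  obtain F G :: "complex ^ 'n \<Rightarrow> complex ^ 'n" and \<mu> :: "complex ^ 'n \<Rightarrow> 'n \<Rightarrow> complex" where F:
    "\<And>w. w \<in> {w. p + B *v w \<in> D} \<Longrightarrow> (F has_derivative (\<lambda>v. \<chi> i. \<mu> w i * v $ i)) (at w)"
    "\<And>w i. w \<in> {w. p + B *v w \<in> D} \<Longrightarrow> \<mu> w i \<noteq> 0"
    "F ` {w. p + B *v w \<in> D} \<subseteq> ball 0 1" "F 0 = 0"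
    "\<And>w. w \<in> {w. p + B *v w \<in> D} \<Longrightarrow> G (F w) = w"
    "continuous_on (F ` {w. p + B *v w \<in> D}) G"
    "ball 0 ((1 / sqrt CARD('n)) ^ 4 / 144) \<subseteq> F ` {w. p + B *v w \<in> D}"
    by (rule normal_position_embedding[OF E ball]) (use ne1 in blast)+
  obtain f where "f \<in> centred_embeddings D p" "f ` D = F ` {w. p + B *v w \<in> D}"
    by (rule centred_embeddingsI[OF AB F(1-6)])
  then show "(1 / sqrt (real CARD('n))) ^ 4 / 144 \<le> squeezing_function D p"
    using F(7) by (intro squeezing_function_ge) auto
qed

end
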